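(* Let $R$ be a ring and let $M = S_1^{t_1}\oplus\dots\oplus S_n^{t_n}$ be a semisimple $R$-module with only finitely many submodules, where $S_1,\dots,S_n$ are pairwise non-isomorphic simple $R$-modules and $t_1,\dots,t_n$ are natural numbers. Then $$\mu_R(M)=\prod_{1\leq i\leq n}\mu_R(S_i^{t_i}).$$
   Context: Rings are associative with unity (not necessarily commutative); modules are left modules. For an $R$-module $M$ with a finite set $\mathcal{L}(M)$ of submodules, the integer $\mu_R(M)$ is defined recursively by $\mu_R(0):=1$ and, for $M\neq 0$, by requiring $\sum_{N\in\mathcal{L}(M)}\mu_R(N)=0$ (the sum includes $N=M$). *)

theory Defs
  imports "HOL-Algebra.Module"
begin

text \<open>
  The library locale \<open>module\<close> demands a commutative base ring. Its record type and its
  \<open>submodule\<close> predicate do not, and are reused here over an arbitrary unital ring. The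
  multiplicative fields of the module record carry no meaning.
\<close>

locale left_module = R?: ring R + M?: abelian_group M
  for R :: "('a, 'r) ring_scheme" (structure) and M :: "('a, 'b, 'm) module_scheme" (structure) +
  assumes smult_closed [simp, intro]:
      "\<lbrakk>a \<in> carrier R; x \<in> carrier M\<rbrakk> \<Longrightarrow> a \<odot>\<^bsub>M\<^esub> x \<in> carrier M"
    and smult_l_distr:
      "\<lbrakk>a \<in> carrier R; b \<in> carrier R; x \<in> carrier M\<rbrakk> \<Longrightarrow>
       (a \<oplus> b) \<odot>\<^bsub>M\<^esub> x = a \<odot>\<^bsub>M\<^esub> x \<oplus>\<^bsub>M\<^esub> b \<odot>\<^bsub>M\<^esub> x"
    and smult_r_distr:
      "\<lbrakk>a \<in> carrier R; x \<in> carrier M; y \<in> carrier M\<rbrakk> \<Longrightarrow>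
       a \<odot>\<^bsub>M\<^esub> (x \<oplus>\<^bsub>M\<^esub> y) = a \<odot>\<^bsub>M\<^esub> x \<oplus>\<^bsub>M\<^esub> a \<odot>\<^bsub>M\<^esub> y"
    and smult_assoc1:
      "\<lbrakk>a \<in> carrier R; b \<in> carrier R; x \<in> carrier M\<rbrakk> \<Longrightarrow>
       (a \<otimes> b) \<odot>\<^bsub>M\<^esub> x = a \<odot>\<^bsub>M\<^esub> (b \<odot>\<^bsub>M\<^esub> x)"
    and smult_one [simp]:
      "x \<in> carrier M \<Longrightarrow> \<one> \<odot>\<^bsub>M\<^esub> x = x"

definition submodules ::
    "('a, 'r) ring_scheme \<Rightarrow> ('a, 'b, 'm) module_scheme \<Rightarrow> 'b set set"
  where "submodules R M = {N. submodule N R M}"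

definition simple_module ::
    "('a, 'r) ring_scheme \<Rightarrow> ('a, 'b, 'm) module_scheme \<Rightarrow> bool"
  where "simple_module R M \<longleftrightarrow>
    left_module R M \<and> carrier M \<noteq> {\<zero>\<^bsub>M\<^esub>} \<and>
    (\<forall>N \<in> submodules R M. N = {\<zero>\<^bsub>M\<^esub>} \<or> N = carrier M)"

definition module_isomorphic ::
    "('a, 'r) ring_scheme \<Rightarrow> ('a, 'b, 'm) module_scheme \<Rightarrow> ('a, 'c, 'n) module_scheme \<Rightarrow> bool"
  where "module_isomorphic R M N \<longleftrightarrow>
    (\<exists>f \<in> iso (add_monoid M) (add_monoid N).
       \<forall>a \<in> carrier R. \<forall>x \<in> carrier M. f (a \<odot>\<^bsub>M\<^esub> x) = a \<odot>\<^bsub>N\<^esub> f x)"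

text \<open>The external direct sum of a finite family. No finite support condition is imposed, so
  this is the direct sum only when \<open>I\<close> is finite.\<close>

definition finite_direct_sum :: "'i set \<Rightarrow> ('i \<Rightarrow> ('a, 'b, 'm) module_scheme) \<Rightarrow> ('a, 'i \<Rightarrow> 'b) module"
  where "finite_direct_sum I M =
    \<lparr>carrier = (\<Pi>\<^sub>E i\<in>I. carrier (M i)),
     mult = undefined,
     one = undefined,
     zero = (\<lambda>i\<in>I. \<zero>\<^bsub>M i\<^esub>),
     add = (\<lambda>x y. \<lambda>i\<in>I. x i \<oplus>\<^bsub>M i\<^esub> y i),
     smult = (\<lambda>a x. \<lambda>i\<in>I. a \<odot>\<^bsub>M i\<^esub> x i)\<rparr>"

definition module_power :: "('a, 'b, 'm) module_scheme \<Rightarrow> nat \<Rightarrow> ('a, nat \<Rightarrow> 'b) module"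
  where "module_power S t = finite_direct_sum {1..t} (\<lambda>_. S)"

lemma submodule_trans:
  assumes M: "left_module R M" and N: "submodule N R M"
    and N': "submodule N' R (M\<lparr>carrier := N\<rparr>)"
  shows "submodule N' R M"
proof -
  interpret left_module R M by fact
  have 1: "subgroup N (add_monoid M)"
    using N by (rule submodule.axioms)
  have 2: "subgroup N' (add_monoid (M\<lparr>carrier := N\<rparr>))"
    using N' by (rule submodule.axioms)
  have "subgroup N' (add_monoid M)"
    using M.add.incl_subgroup[of N N'] 1 2 by simp
  then show ?thesis
    using submodule.smult_closed[OF N']
    by (auto intro!: submodule.intro simp: submodule_axioms_def)
qed

lemma carrier_submodule:
  assumes "left_module R M"
  shows "submodule (carrier M) R M"
proof -
  interpret left_module R M by fact
  show ?thesis
    using M.add.subgroup_self by (auto intro!: submodule.intro simp: submodule_axioms_def)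
qed

lemma left_module_submodule:
  assumes M: "left_module R M" and N: "submodule N R M"
  shows "left_module R (M\<lparr>carrier := N\<rparr>)"
proof -
  interpret left_module R M by fact
  let ?N = "M\<lparr>carrier := N\<rparr>"
  have sub: "subgroup N (add_monoid M)"
    using N by (rule submodule.axioms)
  have mem: "x \<in> carrier M" if "x \<in> N" for x
    using subgroup.mem_carrier[OF sub that] by simp
  have "group ((add_monoid M)\<lparr>carrier := N\<rparr>)"
    using sub by (rule M.add.subgroup_imp_group)
  then have "group (add_monoid ?N)"
    by simp
  then have "comm_group (add_monoid ?N)"
    by (rule group.group_comm_groupI) (simp add: mem M.a_comm)
  then have "abelian_group ?N"
    by (intro abelian_group.intro abelian_monoid.intro abelian_group_axioms.intro
        comm_group.axioms(1))
  then show ?thesis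
    by (intro left_module.intro left_module_axioms.intro R.ring_axioms)
      (simp_all add: mem smult_l_distr smult_r_distr smult_assoc1 submodule.smult_closed[OF N])
qed

lemma card_submodules_less:
  assumes M: "left_module R M" and fin: "finite (submodules R M)"
    and N: "N \<in> submodules R M - {carrier M}"
  shows "card (submodules R (M\<lparr>carrier := N\<rparr>)) < card (submodules R M)"
proof (rule psubset_card_mono[OF fin])
  interpret left_module R M by fact
  have sub: "submodule N R M" and ne: "N \<noteq> carrier M"
    using N by (auto simp: submodules_def)
  have "carrier M \<notin> submodules R (M\<lparr>carrier := N\<rparr>)"
  proof
    assume "carrier M \<in> submodules R (M\<lparr>carrier := N\<rparr>)"
    then have "carrier M \<subseteq> N"
      by (auto simp: submodules_def dest!: submodule.axioms(1) dest: subgroup.mem_carrier)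
    moreover have "N \<subseteq> carrier M"
      using submodule.axioms(1)[OF sub] by (auto dest: subgroup.mem_carrier)
    ultimately show False using ne by auto
  qed
  moreover have "carrier M \<in> submodules R M"
    using carrier_submodule[OF M] by (simp add: submodules_def)
  moreover have "submodules R (M\<lparr>carrier := N\<rparr>) \<subseteq> submodules R M"
    using submodule_trans[OF M sub] by (auto simp: submodules_def)
  ultimately show "submodules R (M\<lparr>carrier := N\<rparr>) \<subset> submodules R M"
    by blast
qed

text \<open>
  The recursive equation is \<open>\<Sum>N\<in>\<L>(M). \<mu>(N) = 0\<close> solved for its top term. Outside its
  domain (not a left module, or infinitely many submodules) \<open>mu\<close> takes the dummy value \<open>0\<close>.
\<close>

function mu :: "('a, 'r) ring_scheme \<Rightarrow> ('a, 'b, 'm) module_scheme \<Rightarrow> int" where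
  "mu R M =
    (if \<not> left_module R M \<or> infinite (submodules R M) then 0
     else if carrier M = {\<zero>\<^bsub>M\<^esub>} then 1
     else - (\<Sum>N \<in> submodules R M - {carrier M}. mu R (M\<lparr>carrier := N\<rparr>)))"
  by pat_completeness auto
termination
  by (relation "measure (\<lambda>(R, M). card (submodules R M))")
    (use card_submodules_less in force)+

declare mu.simps [simp del]

lemma mu_zero_module:
  assumes "left_module R M" and "carrier M = {\<zero>\<^bsub>M\<^esub>}"
  shows "mu R M = 1"
proof -
  have "submodules R M \<subseteq> Pow (carrier M)"
    by (auto simp: submodules_def dest!: submodule.axioms(1) dest: subgroup.mem_carrier)
  then have "finite (submodules R M)"
    using assms(2) by (auto intro: finite_subset)
  then show ?thesis
    using assms by (subst mu.simps) auto
qed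

lemma sum_mu_submodules:
  assumes "left_module R M" and "finite (submodules R M)" and "carrier M \<noteq> {\<zero>\<^bsub>M\<^esub>}"
  shows "(\<Sum>N \<in> submodules R M. mu R (M\<lparr>carrier := N\<rparr>)) = 0"
proof -
  have "carrier M \<in> submodules R M"
    using carrier_submodule[OF assms(1)] by (simp add: submodules_def)
  then have "(\<Sum>N \<in> submodules R M. mu R (M\<lparr>carrier := N\<rparr>)) =
      mu R M + (\<Sum>N \<in> submodules R M - {carrier M}. mu R (M\<lparr>carrier := N\<rparr>))"
    using assms(2) by (subst sum.remove[of _ "carrier M"]) auto
  also have "\<dots> = 0"
    using assms by (subst mu.simps) simp
  finally show ?thesis .
qed

end

theory Submission
  imports Defs
begin

text \<open>
  When all submodules of a finite direct sum are products of submodules of the summands, the sum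
  of the products of the \<open>\<mu>\<close>-values over all submodules factors as a product of sums, so it vanishes
  as soon as one summand is nonzero; induction on the number of submodules then shows that \<open>\<mu>\<close> is
  multiplicative. For isotypic components belonging to pairwise non-isomorphic simple modules the
  submodules are products because, as in the Jacobson density theorem, for each \<open>x\<close> some ring
  element fixes one component of \<open>x\<close> and annihilates all the others.
\<close>

section \<open>Arithmetic in left modules and criteria for submodules\<close>

context left_module
begin

lemma smult_l_null [simp]:
  assumes "x \<in> carrier M"
  shows "\<zero> \<odot>\<^bsub>M\<^esub> x = \<zero>\<^bsub>M\<^esub>"
proof -
  have "\<zero> \<odot>\<^bsub>M\<^esub> x \<oplus>\<^bsub>M\<^esub> \<zero> \<odot>\<^bsub>M\<^esub> x = \<zero> \<odot>\<^bsub>M\<^esub> x"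
    using smult_l_distr[of \<zero> \<zero> x] assms by simp
  then show ?thesis
    using assms by simp
qed

lemma smult_r_null [simp]:
  assumes "a \<in> carrier R"
  shows "a \<odot>\<^bsub>M\<^esub> \<zero>\<^bsub>M\<^esub> = \<zero>\<^bsub>M\<^esub>"
proof -
  have "a \<odot>\<^bsub>M\<^esub> \<zero>\<^bsub>M\<^esub> \<oplus>\<^bsub>M\<^esub> a \<odot>\<^bsub>M\<^esub> \<zero>\<^bsub>M\<^esub> = a \<odot>\<^bsub>M\<^esub> \<zero>\<^bsub>M\<^esub>"
    using smult_r_distr[of a "\<zero>\<^bsub>M\<^esub>" "\<zero>\<^bsub>M\<^esub>"] assms by simp
  then show ?thesis
    using assms by simp
qed

lemma smult_l_minus:
  assumes "a \<in> carrier R" "x \<in> carrier M"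
  shows "(\<ominus> a) \<odot>\<^bsub>M\<^esub> x = \<ominus>\<^bsub>M\<^esub> (a \<odot>\<^bsub>M\<^esub> x)"
proof (rule M.minus_equality[symmetric])
  show "(\<ominus> a) \<odot>\<^bsub>M\<^esub> x \<oplus>\<^bsub>M\<^esub> a \<odot>\<^bsub>M\<^esub> x = \<zero>\<^bsub>M\<^esub>"
    using smult_l_distr[of "\<ominus> a" a x] assms by (simp add: R.l_neg)
qed (use assms in auto)

lemma smult_l_diff:
  assumes "a \<in> carrier R" "b \<in> carrier R" "x \<in> carrier M"
  shows "(a \<ominus> b) \<odot>\<^bsub>M\<^esub> x = a \<odot>\<^bsub>M\<^esub> x \<ominus>\<^bsub>M\<^esub> b \<odot>\<^bsub>M\<^esub> x"
  using assms by (simp add: R.minus_eq M.minus_eq smult_l_distr smult_l_minus)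

lemma smult_l_diff_eq_zero_iff:
  assumes "a \<in> carrier R" "b \<in> carrier R" "x \<in> carrier M"
  shows "(a \<ominus> b) \<odot>\<^bsub>M\<^esub> x = \<zero>\<^bsub>M\<^esub> \<longleftrightarrow> a \<odot>\<^bsub>M\<^esub> x = b \<odot>\<^bsub>M\<^esub> x"
  using assms by (simp add: smult_l_diff M.minus_eq M.r_neg M.add.inv_solve_right')

text \<open>Closure under negation comes for free over a unital ring, because the negative of
  \<open>x\<close> is the multiple of \<open>x\<close> by \<open>\<ominus> \<one>\<close>.\<close>

lemma submoduleI:
  assumes "H \<subseteq> carrier M" "\<zero>\<^bsub>M\<^esub> \<in> H"
    and "\<And>x y. \<lbrakk>x \<in> H; y \<in> H\<rbrakk> \<Longrightarrow> x \<oplus>\<^bsub>M\<^esub> y \<in> H"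
    and smult: "\<And>a x. \<lbrakk>a \<in> carrier R; x \<in> H\<rbrakk> \<Longrightarrow> a \<odot>\<^bsub>M\<^esub> x \<in> H"
  shows "submodule H R M"
proof -
  have "\<ominus>\<^bsub>M\<^esub> x \<in> H" if "x \<in> H" for x
    using smult[of "\<ominus> \<one>" x] that assms(1) smult_l_minus[of \<one> x] by auto
  then show ?thesis
    using assms
    by (auto intro!: submodule.intro subgroup.intro simp: submodule_axioms_def a_inv_def)
qed

end

lemma
  assumes "submodule H R M"
  shows submodule_subset: "H \<subseteq> carrier M"
    and submodule_zero: "\<zero>\<^bsub>M\<^esub> \<in> H"
    and submodule_add: "\<lbrakk>x \<in> H; y \<in> H\<rbrakk> \<Longrightarrow> x \<oplus>\<^bsub>M\<^esub> y \<in> H"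
    and submodule_smult: "\<lbrakk>a \<in> carrier R; x \<in> H\<rbrakk> \<Longrightarrow> a \<odot>\<^bsub>M\<^esub> x \<in> H"
proof -
  interpret submodule H R M by fact
  show "H \<subseteq> carrier M" "\<zero>\<^bsub>M\<^esub> \<in> H"
    using subset one_closed by auto
  show "\<lbrakk>x \<in> H; y \<in> H\<rbrakk> \<Longrightarrow> x \<oplus>\<^bsub>M\<^esub> y \<in> H"
    using m_closed by auto
  show "\<lbrakk>a \<in> carrier R; x \<in> H\<rbrakk> \<Longrightarrow> a \<odot>\<^bsub>M\<^esub> x \<in> H"
    by (rule smult_closed)
qed

text \<open>Converse of \<open>submodule_trans\<close>: together they identify the submodules of
  \<open>N\<close> with the submodules of \<open>M\<close> lying inside \<open>N\<close>.\<close>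

lemma submodule_restrict:
  assumes M: "left_module R M" and N: "submodule N R M" and K: "submodule K R M" and "K \<subseteq> N"
  shows "submodule K R (M\<lparr>carrier := N\<rparr>)"
proof -
  interpret N: left_module R "M\<lparr>carrier := N\<rparr>"
    by (rule left_module_submodule[OF M N])
  show ?thesis
    using assms(4) submodule_zero[OF K] submodule_add[OF K] submodule_smult[OF K]
    by (intro N.submoduleI) auto
qed

subsection \<open>Invariance under isomorphism\<close>

text \<open>Stated for linear maps rather than isomorphisms because it also serves the coordinate
  projections of a direct sum.\<close>

lemma submodule_image:
  assumes M: "left_module R M" and N: "left_module R N"
    and f: "f \<in> hom (add_monoid M) (add_monoid N)"
    and smult: "\<And>a x. \<lbrakk>a \<in> carrier R; x \<in> carrier M\<rbrakk> \<Longrightarrow> f (a \<odot>\<^bsub>M\<^esub> x) = a \<odot>\<^bsub>N\<^esub> f x"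
    and K: "submodule K R M"
  shows "submodule (f ` K) R N"
proof -
  interpret M: left_module R M by fact
  interpret N: left_module R N by fact
  note sub = subsetD[OF submodule_subset[OF K]]
  have zero: "f \<zero>\<^bsub>M\<^esub> = \<zero>\<^bsub>N\<^esub>"
    using hom_one[OF f] M.a_group N.a_group by simp
  have add: "f (x \<oplus>\<^bsub>M\<^esub> y) = f x \<oplus>\<^bsub>N\<^esub> f y" if "x \<in> K" "y \<in> K" for x y
    using hom_mult[OF f, of x y] sub that by simp
  show ?thesis
  proof (rule N.submoduleI)
    show "f ` K \<subseteq> carrier N"
      using hom_carrier[OF f] sub by auto
    show "\<zero>\<^bsub>N\<^esub> \<in> f ` K"
      using zero submodule_zero[OF K] by (metis image_eqI)
    show "u \<oplus>\<^bsub>N\<^esub> v \<in> f ` K" if "u \<in> f ` K" "v \<in> f ` K" for u v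
      using that add submodule_add[OF K] by (metis (no_types, lifting) image_iff)
    show "a \<odot>\<^bsub>N\<^esub> u \<in> f ` K" if "a \<in> carrier R" "u \<in> f ` K" for a u
      using that smult sub submodule_smult[OF K] by (metis (no_types, lifting) image_iff)
  qed
qed

lemma submodules_bij_betw:
  assumes M: "left_module R M" and N: "left_module R N"
    and f: "f \<in> iso (add_monoid M) (add_monoid N)"
    and smult: "\<And>a x. \<lbrakk>a \<in> carrier R; x \<in> carrier M\<rbrakk> \<Longrightarrow> f (a \<odot>\<^bsub>M\<^esub> x) = a \<odot>\<^bsub>N\<^esub> f x"
  shows "bij_betw (image f) (submodules R M) (submodules R N)"
proof -
  interpret M: left_module R M by fact
  interpret N: left_module R N by fact
  have bij: "bij_betw f (carrier M) (carrier N)" and hom: "f \<in> hom (add_monoid M) (add_monoid N)"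
    using f by (auto simp: iso_def)
  define g where "g = inv_into (carrier M) f"
  have "g \<in> iso (add_monoid N) (add_monoid M)"
    using group.iso_set_sym[OF M.a_group f] by (simp add: g_def)
  then have g: "g \<in> hom (add_monoid N) (add_monoid M)"
    by (auto simp: iso_def)
  have gf: "g (f x) = x" if "x \<in> carrier M" for x
    using that bij unfolding g_def by (rule bij_betw_inv_into_left[rotated])
  have fg: "f (g y) = y" if "y \<in> carrier N" for y
    using that bij unfolding g_def by (rule bij_betw_inv_into_right[rotated])
  have gN: "g y \<in> carrier M" if "y \<in> carrier N" for y
    using hom_carrier[OF g] that by auto
  \<comment> \<open>Linearity of the inverse: \<open>y\<close> is \<open>f (g y)\<close>, so the
    scalar moves inside \<open>f\<close>, which \<open>g\<close> then cancels.\<close>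
  have gsmult: "g (a \<odot>\<^bsub>N\<^esub> y) = a \<odot>\<^bsub>M\<^esub> g y" if "a \<in> carrier R" "y \<in> carrier N" for a y
    using that gf[of "a \<odot>\<^bsub>M\<^esub> g y"] smult[of a "g y"] gN fg by simp
  show ?thesis
  proof (rule bij_betw_byWitness[where f' = "image g"])
    show "\<forall>K \<in> submodules R M. g ` f ` K = K"
      using gf by (force simp: submodules_def image_image dest!: submodule_subset)
    show "\<forall>K \<in> submodules R N. f ` g ` K = K"
      using fg by (force simp: submodules_def image_image dest!: submodule_subset)
    show "image f ` submodules R M \<subseteq> submodules R N"
      using submodule_image[OF M N hom smult] by (auto simp: submodules_def)
    show "image g ` submodules R N \<subseteq> submodules R M"
      using submodule_image[OF N M g gsmult] by (auto simp: submodules_def)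
  qed
qed

lemma mu_isomorphic:
  fixes M :: "('a, 'b, 'm) module_scheme" and N :: "('a, 'c, 'n) module_scheme"
  assumes "left_module R M" and "left_module R N" and "module_isomorphic R M N"
  shows "mu R M = mu R N"
proof (cases "finite (submodules R M)")
  case True
  then show ?thesis
    using assms
  proof (induction "card (submodules R M)" arbitrary: M N rule: less_induct)
    case less
    obtain f where f: "f \<in> iso (add_monoid M) (add_monoid N)"
      and smult: "\<And>a x. \<lbrakk>a \<in> carrier R; x \<in> carrier M\<rbrakk> \<Longrightarrow> f (a \<odot>\<^bsub>M\<^esub> x) = a \<odot>\<^bsub>N\<^esub> f x"
      using less.prems(4) by (auto simp: module_isomorphic_def)
    interpret M: left_module R M by (rule less.prems(2))
    interpret N: left_module R N by (rule less.prems(3))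
    note bij = submodules_bij_betw[OF less.prems(2,3) f smult]
    have fbij: "bij_betw f (carrier M) (carrier N)" and hom: "f \<in> hom (add_monoid M) (add_monoid N)"
      using f by (auto simp: iso_def)
    have img: "f ` carrier M = carrier N"
      using fbij by (simp add: bij_betw_def)
    have finN: "finite (submodules R N)"
      using bij less.prems(1) bij_betw_finite by blast
    have zero: "f \<zero>\<^bsub>M\<^esub> = \<zero>\<^bsub>N\<^esub>"
      using hom_one[OF hom] M.a_group N.a_group by simp
    \<comment> \<open>Ensures that both sides fall into the same branch of the definition of
      \<open>mu\<close>.\<close>
    have triv: "carrier M = {\<zero>\<^bsub>M\<^esub>} \<longleftrightarrow> carrier N = {\<zero>\<^bsub>N\<^esub>}"
    proof
      assume "carrier M = {\<zero>\<^bsub>M\<^esub>}"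
      then show "carrier N = {\<zero>\<^bsub>N\<^esub>}"
        using img zero by auto
    next
      assume "carrier N = {\<zero>\<^bsub>N\<^esub>}"
      then have "x = \<zero>\<^bsub>M\<^esub>" if "x \<in> carrier M" for x
        using inj_onD[OF bij_betw_imp_inj_on[OF fbij], of x "\<zero>\<^bsub>M\<^esub>"]
          imageI[OF that, of f] img zero that by simp
      then show "carrier M = {\<zero>\<^bsub>M\<^esub>}"
        using M.zero_closed by blast
    qed
    have top: "carrier M \<in> submodules R M"
      using carrier_submodule[OF less.prems(2)] by (simp add: submodules_def)
    have "bij_betw (image f) (submodules R M - {carrier M}) (submodules R N - {f ` carrier M})"
      by (rule bij_betw_DiffI[OF bij]) (use top carrier_submodule[OF less.prems(3)] img in \<open>auto simp: submodules_def\<close>)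
    then have bij': "bij_betw (image f) (submodules R M - {carrier M}) (submodules R N - {carrier N})"
      by (simp add: img)
    have "mu R (M\<lparr>carrier := K\<rparr>) = mu R (N\<lparr>carrier := f ` K\<rparr>)"
      if K: "K \<in> submodules R M - {carrier M}" for K
    proof (rule less.hyps)
      have sub: "submodule K R M" "submodule (f ` K) R N"
        using K bij by (auto simp: submodules_def bij_betw_def)
      note KM = subsetD[OF submodule_subset[OF sub(1)]]
      show "card (submodules R (M\<lparr>carrier := K\<rparr>)) < card (submodules R M)"
        by (rule card_submodules_less[OF less.prems(2,1) K])
      have "submodules R (M\<lparr>carrier := K\<rparr>) \<subseteq> submodules R M"
        using submodule_trans[OF less.prems(2) sub(1)] by (auto simp: submodules_def)
      then show "finite (submodules R (M\<lparr>carrier := K\<rparr>))"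
        using less.prems(1) by (rule finite_subset)
      show "left_module R (M\<lparr>carrier := K\<rparr>)" "left_module R (N\<lparr>carrier := f ` K\<rparr>)"
        using left_module_submodule less.prems(2,3) sub by blast+
      have "f \<in> iso (add_monoid (M\<lparr>carrier := K\<rparr>)) (add_monoid (N\<lparr>carrier := f ` K\<rparr>))"
        using hom_mult[OF hom] KM fbij
        by (auto simp: iso_def hom_def bij_betw_def intro: inj_on_subset)
      then show "module_isomorphic R (M\<lparr>carrier := K\<rparr>) (N\<lparr>carrier := f ` K\<rparr>)"
        using smult KM by (auto simp: module_isomorphic_def)
    qed
    then have "(\<Sum>K \<in> submodules R M - {carrier M}. mu R (M\<lparr>carrier := K\<rparr>)) =
        (\<Sum>K \<in> submodules R N - {carrier N}. mu R (N\<lparr>carrier := K\<rparr>))"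
      by (subst sum.reindex_bij_betw[OF bij', symmetric]) (rule sum.cong, auto)
    then show ?case
      using less.prems(1-3) finN triv by (subst (1 2) mu.simps) simp
  qed
next
  case False
  \<comment> \<open>Infinitely many submodules on one side force infinitely many on the other, so
    both values are the dummy \<open>0\<close>.\<close>
  then have "infinite (submodules R N)"
    using assms submodules_bij_betw[OF assms(1,2)] bij_betw_finite
    by (fastforce simp: module_isomorphic_def)
  with False show ?thesis
    by (subst (1 2) mu.simps) simp
qed

subsection \<open>Direct sums whose submodules are boxes\<close>

lemma finite_direct_sum_simps [simp]:
  "carrier (finite_direct_sum I M) = (\<Pi>\<^sub>E i\<in>I. carrier (M i))"
  "\<zero>\<^bsub>finite_direct_sum I M\<^esub> = (\<lambda>i\<in>I. \<zero>\<^bsub>M i\<^esub>)"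
  "x \<oplus>\<^bsub>finite_direct_sum I M\<^esub> y = (\<lambda>i\<in>I. x i \<oplus>\<^bsub>M i\<^esub> y i)"
  "a \<odot>\<^bsub>finite_direct_sum I M\<^esub> x = (\<lambda>i\<in>I. a \<odot>\<^bsub>M i\<^esub> x i)"
  by (simp_all add: finite_direct_sum_def)

lemma left_module_finite_direct_sum:
  assumes "ring R" and M: "\<And>i. i \<in> I \<Longrightarrow> left_module R (M i)"
  shows "left_module R (finite_direct_sum I M)"
proof -
  have ab: "abelian_group (M i)" if "i \<in> I" for i
    using M[OF that] by (rule left_module.axioms)
  note monoid = abelian_group.axioms(1)[OF ab]
  have "abelian_group (finite_direct_sum I M)"
  proof (rule abelian_groupI)
    fix x
    assume "x \<in> carrier (finite_direct_sum I M)"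
    then have x: "x i \<in> carrier (M i)" if "i \<in> I" for i
      using that by auto
    show "\<exists>y \<in> carrier (finite_direct_sum I M).
        y \<oplus>\<^bsub>finite_direct_sum I M\<^esub> x = \<zero>\<^bsub>finite_direct_sum I M\<^esub>"
      by (rule bexI[of _ "\<lambda>i\<in>I. \<ominus>\<^bsub>M i\<^esub> x i"])
        (use x in \<open>auto simp: abelian_group.l_neg[OF ab] abelian_group.a_inv_closed[OF ab]
          intro!: restrict_ext\<close>)
  qed (auto simp: fun_eq_iff PiE_iff extensional_def abelian_monoid.a_closed[OF monoid]
      abelian_monoid.zero_closed[OF monoid] abelian_monoid.a_assoc[OF monoid]
      abelian_monoid.l_zero[OF monoid] intro: abelian_monoid.a_comm[OF monoid])
  then show ?thesis
    by (intro left_module.intro left_module_axioms.intro assms(1))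
      (auto simp: fun_eq_iff PiE_iff extensional_def left_module.smult_closed[OF M]
        left_module.smult_l_distr[OF M] left_module.smult_r_distr[OF M]
        left_module.smult_assoc1[OF M] left_module.smult_one[OF M])
qed

text \<open>All operations are componentwise. This is one half of the correspondence between boxes
  and submodules; the other half is a hypothesis of \<open>mu_finite_direct_sum\<close>.\<close>

lemma submodule_PiE:
  assumes "ring R" and M: "\<And>i. i \<in> I \<Longrightarrow> left_module R (M i)"
    and N: "\<And>i. i \<in> I \<Longrightarrow> submodule (N i) R (M i)"
  shows "submodule (PiE I N) R (finite_direct_sum I M)"
proof -
  interpret left_module R "finite_direct_sum I M"
    by (rule left_module_finite_direct_sum[OF assms(1,2)])
  show ?thesis
    using submodule_subset[OF N] submodule_zero[OF N] submodule_add[OF N] submodule_smult[OF N]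
    by (intro submoduleI) (auto simp: PiE_mem intro!: PiE_mono)
qed

text \<open>A box is literally a finite direct sum again, so an induction hypothesis about direct
  sums applies to it without passing to an isomorphic copy.\<close>

lemma finite_direct_sum_restrict:
  "(finite_direct_sum I M)\<lparr>carrier := PiE I N\<rparr> = finite_direct_sum I (\<lambda>i. (M i)\<lparr>carrier := N i\<rparr>)"
  by (simp add: finite_direct_sum_def)

text \<open>Summed over all boxes, both \<open>mu\<close> and the product of the
  \<open>mu\<close>-values of the factors give \<open>0\<close> when some summand is nonzero. By
  induction they agree on every proper box, hence also on the full one.\<close>

lemma mu_finite_direct_sum:
  fixes R :: "('a, 'r) ring_scheme" and M :: "'i \<Rightarrow> ('a, 'b, 'm) module_scheme"
  assumes "finite I" and "ring R" and "\<And>i. i \<in> I \<Longrightarrow> left_module R (M i)"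
    and "finite (submodules R (finite_direct_sum I M))"
    and "submodules R (finite_direct_sum I M) \<subseteq> PiE I ` (\<Pi>\<^sub>E i\<in>I. submodules R (M i))"
  shows "mu R (finite_direct_sum I M) = (\<Prod>i\<in>I. mu R (M i))"
  using assms(3-)
proof (induction "card (submodules R (finite_direct_sum I M))" arbitrary: M rule: less_induct)
  case less
  let ?D = "finite_direct_sum I M"
  let ?B = "\<Pi>\<^sub>E i\<in>I. submodules R (M i)"
  have D: "left_module R ?D"
    by (rule left_module_finite_direct_sum[OF assms(2) less.prems(1)])
  \<comment> \<open>Each factor contains zero. Nonemptiness matters because only nonempty boxes
    determine their factors.\<close>
  have ne: "PiE I N \<noteq> {}" if "N \<in> ?B" for N
    using that submodule_zero by (fastforce simp: PiE_eq_empty_iff submodules_def)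
  have sub: "PiE I N \<in> submodules R ?D" if "N \<in> ?B" for N
    using that unfolding submodules_def
    by (intro CollectI submodule_PiE[OF assms(2) less.prems(1)]) auto
  have inj: "inj_on (PiE I) ?B"
  proof (rule inj_onI)
    fix N K
    assume *: "N \<in> ?B" "K \<in> ?B" "PiE I N = PiE I K"
    then have "\<forall>i\<in>I. N i = K i"
      using ne[of N] ne[of K] by (auto simp: PiE_eq_iff PiE_eq_empty_iff)
    then show "N = K"
      by (intro PiE_ext[OF *(1,2)]) simp
  qed
  have bij: "bij_betw (PiE I) ?B (submodules R ?D)"
    by (intro bij_betw_imageI[OF inj] equalityI less.prems(3) image_subsetI sub)
  have finB: "finite ?B"
    using bij less.prems(2) bij_betw_finite by blast
  \<comment> \<open>A submodule \<open>N\<close> of the summand \<open>M i\<close> is encoded as the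
    tuple with entry \<open>N\<close> at \<open>i\<close> and the full carriers elsewhere; this
    embeds the submodules of \<open>M i\<close> into the finite set \<open>?B\<close>.\<close>
  have fin: "finite (submodules R (M i))" if i: "i \<in> I" for i
  proof (rule inj_on_finite[OF _ _ finB])
    let ?F = "\<lambda>N. \<lambda>j\<in>I. if j = i then N else carrier (M j)"
    show "inj_on ?F (submodules R (M i))"
      using i by (auto intro!: inj_onI dest: fun_cong[of _ _ i])
    show "?F ` submodules R (M i) \<subseteq> ?B"
      using i carrier_submodule[OF less.prems(1)]
      by (auto simp: submodules_def)
  qed
  define top where "top = (\<lambda>i\<in>I. carrier (M i))"
  have top: "top \<in> ?B"
    using carrier_submodule[OF less.prems(1)] by (auto simp: top_def submodules_def)
  have PiE_top: "PiE I top = carrier ?D"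
    by (simp add: top_def cong: PiE_cong)
  show ?case
  proof (cases "\<forall>i\<in>I. carrier (M i) = {\<zero>\<^bsub>M i\<^esub>}")
    case True
    \<comment> \<open>All summands are zero, which includes the case of empty \<open>I\<close>; both
      sides equal \<open>1\<close>.\<close>
    have "carrier ?D = {\<zero>\<^bsub>?D\<^esub>}"
      using True PiE_singleton[of "\<lambda>i\<in>I. \<zero>\<^bsub>M i\<^esub>" I] by (simp cong: PiE_cong)
    then show ?thesis
      using mu_zero_module[OF D] mu_zero_module[OF less.prems(1)] True by simp
  next
    case False
    then obtain i where i: "i \<in> I" "carrier (M i) \<noteq> {\<zero>\<^bsub>M i\<^esub>}"
      by blast
    \<comment> \<open>The value that multiplicativity predicts for the box with factors
      \<open>N\<close>.\<close>
    define g where "g N = (\<Prod>i\<in>I. mu R ((M i)\<lparr>carrier := N i\<rparr>))" for N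
    have IH: "mu R (?D\<lparr>carrier := PiE I N\<rparr>) = g N" if N: "N \<in> ?B - {top}" for N
      unfolding finite_direct_sum_restrict g_def
    proof (rule less.hyps; (fold finite_direct_sum_restrict)?)
      have NB: "N \<in> ?B"
        using N by simp
      have ND: "PiE I N \<in> submodules R ?D - {carrier ?D}"
        using N sub[OF NB] inj_onD[OF inj, of N top] top PiE_top by auto
      then show "card (submodules R (?D\<lparr>carrier := PiE I N\<rparr>)) < card (submodules R ?D)"
        by (rule card_submodules_less[OF D less.prems(2)])
      have trans: "submodules R (?D\<lparr>carrier := PiE I N\<rparr>) \<subseteq> submodules R ?D"
        using submodule_trans[OF D] ND by (auto simp: submodules_def)
      then show "finite (submodules R (?D\<lparr>carrier := PiE I N\<rparr>))"
        using less.prems(2) by (rule finite_subset)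
      show "left_module R ((M i)\<lparr>carrier := N i\<rparr>)" if "i \<in> I" for i
        using left_module_submodule[OF less.prems(1)] NB that by (auto simp: submodules_def PiE_mem)
      \<comment> \<open>The box property is inherited: a submodule of the box is a submodule of
        \<open>?D\<close>, hence itself a box, and inclusion of nonempty boxes holds factor by
        factor.\<close>
      show "submodules R (?D\<lparr>carrier := PiE I N\<rparr>)
          \<subseteq> PiE I ` (\<Pi>\<^sub>E i\<in>I. submodules R ((M i)\<lparr>carrier := N i\<rparr>))"
      proof
        fix K
        assume K: "K \<in> submodules R (?D\<lparr>carrier := PiE I N\<rparr>)"
        then obtain L where L: "L \<in> ?B" "K = PiE I L"
          using trans less.prems(3) by blast
        have "PiE I L \<subseteq> PiE I N"
          using K L submodule_subset by (fastforce simp: submodules_def)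
        then have LN: "L i \<subseteq> N i" if "i \<in> I" for i
          using ne[OF L(1)] that by (auto simp: subset_PiE)
        have "L i \<in> submodules R ((M i)\<lparr>carrier := N i\<rparr>)" if "i \<in> I" for i
          using submodule_restrict[OF less.prems(1)[OF that] _ _ LN[OF that]]
            PiE_mem[OF L(1) that] PiE_mem[OF NB that]
          by (simp add: submodules_def)
        then show "K \<in> PiE I ` (\<Pi>\<^sub>E i\<in>I. submodules R ((M i)\<lparr>carrier := N i\<rparr>))"
          using L by (auto simp: PiE_def)
      qed
    qed
    \<comment> \<open>The projection to the nonzero summand \<open>M i\<close> is onto, so the
      direct sum is nonzero and its defining sum vanishes.\<close>
    have "carrier ?D \<noteq> {\<zero>\<^bsub>?D\<^esub>}"
    proof
      assume "carrier ?D = {\<zero>\<^bsub>?D\<^esub>}"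
      then have "(\<lambda>x. x i) ` carrier ?D = {\<zero>\<^bsub>M i\<^esub>}"
        using i by simp
      moreover have "(\<lambda>x. x i) ` carrier ?D = carrier (M i)"
        using i ne[OF top] PiE_top by (simp add: image_projection_PiE)
      ultimately show False
        using i by simp
    qed
    then have "0 = (\<Sum>N \<in> submodules R ?D. mu R (?D\<lparr>carrier := N\<rparr>))"
      using sum_mu_submodules[OF D less.prems(2)] by simp
    also have "\<dots> = (\<Sum>N \<in> ?B. mu R (?D\<lparr>carrier := PiE I N\<rparr>))"
      by (rule sum.reindex_bij_betw[OF bij, symmetric])
    also have "\<dots> = mu R (?D\<lparr>carrier := PiE I top\<rparr>)
        + (\<Sum>N \<in> ?B - {top}. mu R (?D\<lparr>carrier := PiE I N\<rparr>))"
      by (rule sum.remove[OF finB top])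
    also have "\<dots> = mu R ?D + (\<Sum>N \<in> ?B - {top}. g N)"
      unfolding PiE_top by (intro arg_cong2[of _ _ _ _ "(+)"] sum.cong IH)
        (simp_all add: finite_direct_sum_def)
    finally have 1: "mu R ?D + (\<Sum>N \<in> ?B - {top}. g N) = 0"
      by simp
    \<comment> \<open>The factor of the nonzero summand is \<open>0\<close>. Expanding this product
      of sums over all choices of submodules turns it into the sum of \<open>g\<close> over
      \<open>?B\<close>.\<close>
    have "(\<Prod>i\<in>I. \<Sum>N \<in> submodules R (M i). mu R ((M i)\<lparr>carrier := N\<rparr>)) = 0"
      using i assms(1) sum_mu_submodules[OF less.prems(1) fin] by (auto intro!: prod_zero)
    then have "0 = (\<Sum>N \<in> ?B. g N)"
      unfolding g_def by (subst prod_sum_PiE[OF assms(1) fin, symmetric]) auto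
    also have "\<dots> = g top + (\<Sum>N \<in> ?B - {top}. g N)"
      by (rule sum.remove[OF finB top])
    finally have "mu R ?D = g top"
      using 1 by simp
    also have "\<dots> = (\<Prod>i\<in>I. mu R (M i))"
      by (simp add: g_def top_def)
    finally show ?thesis .
  qed
qed

subsection \<open>Separating elements of non-isomorphic simple modules\<close>

text \<open>The left ideals in use are annihilators of finitely many module elements. Closure under
  subtraction follows from multiplication by \<open>\<ominus> \<one>\<close>.\<close>

definition left_ideal :: "'a set \<Rightarrow> ('a, 'r) ring_scheme \<Rightarrow> bool"
  where "left_ideal J R \<longleftrightarrow> J \<subseteq> carrier R \<and> \<zero>\<^bsub>R\<^esub> \<in> J \<and>
    (\<forall>a\<in>J. \<forall>b\<in>J. a \<oplus>\<^bsub>R\<^esub> b \<in> J) \<and> (\<forall>r\<in>carrier R. \<forall>a\<in>J. r \<otimes>\<^bsub>R\<^esub> a \<in> J)"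

lemma left_ideal_diff:
  assumes "ring R" "left_ideal J R" "a \<in> J" "b \<in> J"
  shows "a \<ominus>\<^bsub>R\<^esub> b \<in> J"
proof -
  interpret ring R by fact
  have "a \<oplus>\<^bsub>R\<^esub> (\<ominus>\<^bsub>R\<^esub> \<one>\<^bsub>R\<^esub>) \<otimes>\<^bsub>R\<^esub> b \<in> J" "b \<in> carrier R"
    using assms by (auto simp: left_ideal_def)
  then show ?thesis
    by (simp add: minus_eq l_minus)
qed

context left_module
begin

lemma left_ideal_annihilator:
  assumes "left_ideal J R" "x \<in> carrier M"
  shows "left_ideal {r \<in> J. r \<odot>\<^bsub>M\<^esub> x = \<zero>\<^bsub>M\<^esub>} R"
  using assms smult_l_distr smult_assoc1 by (auto simp: left_ideal_def subset_iff)

lemma submodule_orbit: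
  assumes J: "left_ideal J R" and x: "x \<in> carrier M"
  shows "submodule ((\<lambda>r. r \<odot>\<^bsub>M\<^esub> x) ` J) R M"
proof (rule submoduleI)
  have JR: "r \<in> carrier R" if "r \<in> J" for r
    using J that by (auto simp: left_ideal_def)
  show "(\<lambda>r. r \<odot>\<^bsub>M\<^esub> x) ` J \<subseteq> carrier M"
    using JR x by auto
  show "\<zero>\<^bsub>M\<^esub> \<in> (\<lambda>r. r \<odot>\<^bsub>M\<^esub> x) ` J"
    using J x by (intro image_eqI[of _ _ \<zero>]) (auto simp: left_ideal_def)
  show "u \<oplus>\<^bsub>M\<^esub> v \<in> (\<lambda>r. r \<odot>\<^bsub>M\<^esub> x) ` J"
    if uv: "u \<in> (\<lambda>r. r \<odot>\<^bsub>M\<^esub> x) ` J" "v \<in> (\<lambda>r. r \<odot>\<^bsub>M\<^esub> x) ` J" for u v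
  proof -
    obtain r s where "r \<in> J" "s \<in> J" "u = r \<odot>\<^bsub>M\<^esub> x" "v = s \<odot>\<^bsub>M\<^esub> x"
      using uv by blast
    then show ?thesis
      using J JR x smult_l_distr by (intro image_eqI[of _ _ "r \<oplus> s"]) (auto simp: left_ideal_def)
  qed
  show "a \<odot>\<^bsub>M\<^esub> u \<in> (\<lambda>r. r \<odot>\<^bsub>M\<^esub> x) ` J"
    if a: "a \<in> carrier R" and u: "u \<in> (\<lambda>r. r \<odot>\<^bsub>M\<^esub> x) ` J" for a u
  proof -
    obtain r where "r \<in> J" "u = r \<odot>\<^bsub>M\<^esub> x"
      using u by blast
    then show ?thesis
      using a J JR x smult_assoc1 by (intro image_eqI[of _ _ "a \<otimes> r"]) (auto simp: left_ideal_def)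
  qed
qed

end

text \<open>The orbit is a submodule, and a single nonzero multiple excludes the zero
  submodule.\<close>

lemma simple_module_orbit:
  assumes "simple_module R S" "left_ideal J R" "a \<in> carrier S"
    and "r \<in> J" "r \<odot>\<^bsub>S\<^esub> a \<noteq> \<zero>\<^bsub>S\<^esub>"
  shows "(\<lambda>r. r \<odot>\<^bsub>S\<^esub> a) ` J = carrier S"
  using assms left_module.submodule_orbit[of R S J a]
  by (fastforce simp: simple_module_def submodules_def)

text \<open>If the conclusion failed, then \<open>r a \<mapsto> r c\<close>, for \<open>r\<close> in \<open>J\<close>, would be a well-defined
  isomorphism from \<open>S\<close> to \<open>T\<close>.\<close>

lemma separate_from_one:
  assumes S: "simple_module R S" and T: "simple_module R T" and niso: "\<not> module_isomorphic R S T"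
    and J: "left_ideal J R" and a: "a \<in> carrier S" and c: "c \<in> carrier T"
    and r0: "r0 \<in> J" "r0 \<odot>\<^bsub>S\<^esub> a = a"
  shows "\<exists>r\<in>J. r \<odot>\<^bsub>T\<^esub> c = \<zero>\<^bsub>T\<^esub> \<and> r \<odot>\<^bsub>S\<^esub> a = a"
proof (rule ccontr)
  assume contra: "\<not> ?thesis"
  interpret S: left_module R S
    using S by (simp add: simple_module_def)
  interpret T: left_module R T
    using T by (simp add: simple_module_def)
  have JR: "r \<in> carrier R" if "r \<in> J" for r
    using J that by (auto simp: left_ideal_def)
  note diff = left_ideal_diff[OF S.ring_axioms J]
  have K: "left_ideal {r \<in> J. r \<odot>\<^bsub>T\<^esub> c = \<zero>\<^bsub>T\<^esub>} R"
    by (rule T.left_ideal_annihilator[OF J c])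
  \<comment> \<open>If an element of \<open>J\<close> annihilating \<open>c\<close> moved
    \<open>a\<close> to something nonzero, then by simplicity some such element would send
    \<open>a\<close> to \<open>a\<close>, which \<open>contra\<close> forbids.\<close>
  have kill_a: "r \<odot>\<^bsub>S\<^esub> a = \<zero>\<^bsub>S\<^esub>" if "r \<in> J" "r \<odot>\<^bsub>T\<^esub> c = \<zero>\<^bsub>T\<^esub>" for r
  proof (rule ccontr)
    assume "r \<odot>\<^bsub>S\<^esub> a \<noteq> \<zero>\<^bsub>S\<^esub>"
    then have "(\<lambda>r. r \<odot>\<^bsub>S\<^esub> a) ` {r \<in> J. r \<odot>\<^bsub>T\<^esub> c = \<zero>\<^bsub>T\<^esub>} = carrier S"
      using simple_module_orbit[OF S K a, of r] that by blast
    with a have "a \<in> (\<lambda>r. r \<odot>\<^bsub>S\<^esub> a) ` {r \<in> J. r \<odot>\<^bsub>T\<^esub> c = \<zero>\<^bsub>T\<^esub>}"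
      by simp
    with contra show False
      by auto
  qed
  have K': "left_ideal {r \<in> J. r \<odot>\<^bsub>S\<^esub> a = \<zero>\<^bsub>S\<^esub>} R"
    by (rule S.left_ideal_annihilator[OF J a])
  have "a \<noteq> \<zero>\<^bsub>S\<^esub>"
  proof
    assume "a = \<zero>\<^bsub>S\<^esub>"
    then have "\<zero>\<^bsub>R\<^esub> \<odot>\<^bsub>T\<^esub> c = \<zero>\<^bsub>T\<^esub> \<and> \<zero>\<^bsub>R\<^esub> \<odot>\<^bsub>S\<^esub> a = a"
      using c by simp
    then show False
      using contra J by (auto simp: left_ideal_def)
  qed
  \<comment> \<open>Otherwise the annihilator of \<open>a\<close> in \<open>J\<close> reaches
    \<open>r0 c\<close> by some \<open>k\<close>. Then \<open>r0 - k\<close> kills \<open>c\<close>,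
    hence \<open>a\<close> by \<open>kill_a\<close>, although it sends \<open>a\<close> to
    \<open>a\<close>.\<close>
  have kill_c: "r \<odot>\<^bsub>T\<^esub> c = \<zero>\<^bsub>T\<^esub>" if r: "r \<in> J" "r \<odot>\<^bsub>S\<^esub> a = \<zero>\<^bsub>S\<^esub>" for r
  proof (rule ccontr)
    assume "r \<odot>\<^bsub>T\<^esub> c \<noteq> \<zero>\<^bsub>T\<^esub>"
    then have "(\<lambda>r. r \<odot>\<^bsub>T\<^esub> c) ` {r \<in> J. r \<odot>\<^bsub>S\<^esub> a = \<zero>\<^bsub>S\<^esub>} = carrier T"
      using simple_module_orbit[OF T K' c, of r] r by blast
    then have "r0 \<odot>\<^bsub>T\<^esub> c \<in> (\<lambda>r. r \<odot>\<^bsub>T\<^esub> c) ` {r \<in> J. r \<odot>\<^bsub>S\<^esub> a = \<zero>\<^bsub>S\<^esub>}"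
      using c r0 JR by simp
    then obtain k where k: "k \<in> J" "k \<odot>\<^bsub>S\<^esub> a = \<zero>\<^bsub>S\<^esub>" "k \<odot>\<^bsub>T\<^esub> c = r0 \<odot>\<^bsub>T\<^esub> c"
      by auto
    then have "(r0 \<ominus>\<^bsub>R\<^esub> k) \<odot>\<^bsub>S\<^esub> a = \<zero>\<^bsub>S\<^esub>"
      using r0 JR c by (intro kill_a diff) (auto simp: T.smult_l_diff_eq_zero_iff)
    then show False
      using k r0 JR a \<open>a \<noteq> \<zero>\<^bsub>S\<^esub>\<close> by (simp add: S.smult_l_diff_eq_zero_iff)
  qed
  \<comment> \<open>The annihilators of \<open>a\<close> and \<open>c\<close> in \<open>J\<close>
    coincide. One direction makes the map below well defined, the other makes it injective.\<close>
  have iff: "r \<odot>\<^bsub>S\<^esub> a = s \<odot>\<^bsub>S\<^esub> a \<longleftrightarrow> r \<odot>\<^bsub>T\<^esub> c = s \<odot>\<^bsub>T\<^esub> c" if "r \<in> J" "s \<in> J" for r s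
    using kill_a[OF diff[OF that]] kill_c[OF diff[OF that]] JR[OF that(1)] JR[OF that(2)] a c
    by (auto simp: S.smult_l_diff_eq_zero_iff T.smult_l_diff_eq_zero_iff)
  have orbit_S: "(\<lambda>r. r \<odot>\<^bsub>S\<^esub> a) ` J = carrier S"
    using simple_module_orbit[OF S J a r0(1)] r0 \<open>a \<noteq> \<zero>\<^bsub>S\<^esub>\<close> by simp
  \<comment> \<open>Here \<open>r0 c\<close> is nonzero, since otherwise \<open>kill_a\<close> would
    give \<open>r0 a = 0\<close>, that is \<open>a = 0\<close>.\<close>
  have orbit_T: "(\<lambda>r. r \<odot>\<^bsub>T\<^esub> c) ` J = carrier T"
    using simple_module_orbit[OF T J c r0(1)] kill_a[OF r0(1)] r0 \<open>a \<noteq> \<zero>\<^bsub>S\<^esub>\<close> by auto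
  \<comment> \<open>An arbitrary representative \<open>r\<close> of \<open>x = r a\<close> is
    chosen; by \<open>iff\<close> the value \<open>r c\<close> does not depend on it.\<close>
  define f where "f x = (SOME r. r \<in> J \<and> r \<odot>\<^bsub>S\<^esub> a = x) \<odot>\<^bsub>T\<^esub> c" for x
  have f: "f (r \<odot>\<^bsub>S\<^esub> a) = r \<odot>\<^bsub>T\<^esub> c" if "r \<in> J" for r
    using someI[of "\<lambda>s. s \<in> J \<and> s \<odot>\<^bsub>S\<^esub> a = r \<odot>\<^bsub>S\<^esub> a" r] iff that by (auto simp: f_def)
  have rep: "\<exists>r\<in>J. x = r \<odot>\<^bsub>S\<^esub> a" if "x \<in> carrier S" for x
    using that orbit_S by blast
  have "f (x \<oplus>\<^bsub>S\<^esub> y) = f x \<oplus>\<^bsub>T\<^esub> f y" if xy: "x \<in> carrier S" "y \<in> carrier S" for x y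
  proof -
    obtain r s where rs: "r \<in> J" "s \<in> J" "x = r \<odot>\<^bsub>S\<^esub> a" "y = s \<odot>\<^bsub>S\<^esub> a"
      using rep xy by blast
    moreover have "r \<oplus>\<^bsub>R\<^esub> s \<in> J"
      using J rs by (auto simp: left_ideal_def)
    ultimately show ?thesis
      using f[of "r \<oplus>\<^bsub>R\<^esub> s"] JR a c by (simp add: f S.smult_l_distr T.smult_l_distr)
  qed
  moreover have "f (b \<odot>\<^bsub>S\<^esub> x) = b \<odot>\<^bsub>T\<^esub> f x" if bx: "b \<in> carrier R" "x \<in> carrier S" for b x
  proof -
    obtain r where r: "r \<in> J" "x = r \<odot>\<^bsub>S\<^esub> a"
      using rep bx by blast
    moreover have "b \<otimes>\<^bsub>R\<^esub> r \<in> J"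
      using J r bx by (auto simp: left_ideal_def)
    ultimately show ?thesis
      using f[of "b \<otimes>\<^bsub>R\<^esub> r"] JR a c bx(1) by (simp add: f S.smult_assoc1 T.smult_assoc1)
  qed
  moreover have "bij_betw f (carrier S) (carrier T)"
  proof -
    have "inj_on f (carrier S)"
      using f iff unfolding orbit_S[symmetric] by (auto simp: inj_on_def)
    moreover have "f ` carrier S = carrier T"
      unfolding orbit_S[symmetric] orbit_T[symmetric] image_image using f by simp
    ultimately show ?thesis
      by (simp add: bij_betw_def)
  qed
  ultimately have "module_isomorphic R S T"
    unfolding module_isomorphic_def
    by (intro bexI[of _ f]) (auto simp: iso_def hom_def bij_betw_def)
  with niso show False ..
qed

text \<open>Starting from \<open>\<one>\<close>, \<open>separate_from_one\<close> adds one
  annihilated element at a time. The left ideal conjunct is carried along because it provides the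
  \<open>J\<close> for the next application.\<close>

lemma separate_element:
  assumes "ring R" and S: "simple_module R S" and "finite Q"
    and "\<And>q. q \<in> Q \<Longrightarrow> simple_module R (T q)"
    and "\<And>q. q \<in> Q \<Longrightarrow> \<not> module_isomorphic R S (T q)"
    and "\<And>q. q \<in> Q \<Longrightarrow> c q \<in> carrier (T q)"
    and a: "a \<in> carrier S"
  shows "left_ideal {r \<in> carrier R. \<forall>q\<in>Q. r \<odot>\<^bsub>T q\<^esub> c q = \<zero>\<^bsub>T q\<^esub>} R \<and>
    (\<exists>r\<in>carrier R. (\<forall>q\<in>Q. r \<odot>\<^bsub>T q\<^esub> c q = \<zero>\<^bsub>T q\<^esub>) \<and> r \<odot>\<^bsub>S\<^esub> a = a)"
  using assms(3-6)
proof (induction Q)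
  case empty
  interpret S: left_module R S
    using S by (simp add: simple_module_def)
  show ?case
    using a by (auto simp: left_ideal_def intro!: bexI[of _ "\<one>\<^bsub>R\<^esub>"])
next
  case (insert p Q)
  let ?J = "{r \<in> carrier R. \<forall>q\<in>Q. r \<odot>\<^bsub>T q\<^esub> c q = \<zero>\<^bsub>T q\<^esub>}"
  have J: "left_ideal ?J R" and "\<exists>r\<in>?J. r \<odot>\<^bsub>S\<^esub> a = a"
    using insert by auto
  then obtain r where "r \<in> ?J" "r \<odot>\<^bsub>S\<^esub> a = a"
    by blast
  then have "\<exists>r\<in>?J. r \<odot>\<^bsub>T p\<^esub> c p = \<zero>\<^bsub>T p\<^esub> \<and> r \<odot>\<^bsub>S\<^esub> a = a"
    using insert.prems by (intro separate_from_one[OF S _ _ J a]) auto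
  moreover have "left_ideal {r \<in> ?J. r \<odot>\<^bsub>T p\<^esub> c p = \<zero>\<^bsub>T p\<^esub>} R"
    using insert.prems by (intro left_module.left_ideal_annihilator[OF _ J]) (auto simp: simple_module_def)
  moreover have "{r \<in> ?J. r \<odot>\<^bsub>T p\<^esub> c p = \<zero>\<^bsub>T p\<^esub>} =
      {r \<in> carrier R. \<forall>q\<in>insert p Q. r \<odot>\<^bsub>T q\<^esub> c q = \<zero>\<^bsub>T q\<^esub>}"
    by auto
  ultimately show ?case
    by auto
qed

text \<open>Fixing one element extends to fixing finitely many by correcting the error at each new
  element, as in the proof of the density theorem.\<close>

lemma separate_elements:
  assumes "ring R" and S: "simple_module R S" and "finite Q"
    and "\<And>q. q \<in> Q \<Longrightarrow> simple_module R (T q)"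
    and "\<And>q. q \<in> Q \<Longrightarrow> \<not> module_isomorphic R S (T q)"
    and "\<And>q. q \<in> Q \<Longrightarrow> c q \<in> carrier (T q)"
    and "finite A" "A \<subseteq> carrier S"
  shows "\<exists>r\<in>carrier R. (\<forall>q\<in>Q. r \<odot>\<^bsub>T q\<^esub> c q = \<zero>\<^bsub>T q\<^esub>) \<and> (\<forall>a\<in>A. r \<odot>\<^bsub>S\<^esub> a = a)"
proof -
  interpret S: left_module R S
    using S by (simp add: simple_module_def)
  let ?J = "{r \<in> carrier R. \<forall>q\<in>Q. r \<odot>\<^bsub>T q\<^esub> c q = \<zero>\<^bsub>T q\<^esub>}"
  have sep: "left_ideal ?J R \<and> (\<exists>r\<in>carrier R. (\<forall>q\<in>Q. r \<odot>\<^bsub>T q\<^esub> c q = \<zero>\<^bsub>T q\<^esub>) \<and> r \<odot>\<^bsub>S\<^esub> a = a)"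
    if "a \<in> carrier S" for a
    using that by (intro separate_element assms(1-6))
  then have J: "left_ideal ?J R"
    by blast
  have "\<exists>r\<in>?J. \<forall>a\<in>A. r \<odot>\<^bsub>S\<^esub> a = a"
    using assms(7,8)
  proof (induction A)
    case empty
    show ?case
      using J by (auto simp: left_ideal_def)
  next
    case (insert b A)
    then obtain r where r: "r \<in> ?J" "\<forall>a\<in>A. r \<odot>\<^bsub>S\<^esub> a = a"
      by auto
    have b: "b \<in> carrier S" and A: "A \<subseteq> carrier S"
      using insert.prems by auto
    \<comment> \<open>The error \<open>(1 - r) b\<close> of the current \<open>r\<close> at the new
      element; an \<open>s\<close> fixing this error repairs it.\<close>
    define d where "d = b \<ominus>\<^bsub>S\<^esub> r \<odot>\<^bsub>S\<^esub> b"
    have d: "d \<in> carrier S"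
      using b r by (simp add: d_def)
    obtain s where s: "s \<in> ?J" "s \<odot>\<^bsub>S\<^esub> d = d"
      using sep[OF d] by auto
    \<comment> \<open>\<open>1 - u = (1 - s)(1 - r)\<close>\<close>
    define u where "u = r \<oplus>\<^bsub>R\<^esub> s \<otimes>\<^bsub>R\<^esub> (\<one>\<^bsub>R\<^esub> \<ominus>\<^bsub>R\<^esub> r)"
    \<comment> \<open>In this form \<open>u\<close> visibly lies in the left ideal: the product
      \<open>s r\<close> does because its right factor \<open>r\<close> does.\<close>
    have u': "u = r \<oplus>\<^bsub>R\<^esub> (s \<ominus>\<^bsub>R\<^esub> s \<otimes>\<^bsub>R\<^esub> r)"
      using r s by (simp add: u_def S.R.minus_eq S.R.r_distr S.R.r_minus)
    have "u \<in> ?J"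
      using J r s left_ideal_diff[OF assms(1) J, of s "s \<otimes>\<^bsub>R\<^esub> r"]
      unfolding u' left_ideal_def by (metis (no_types, lifting) subsetD)
    moreover have u: "u \<odot>\<^bsub>S\<^esub> x = r \<odot>\<^bsub>S\<^esub> x \<oplus>\<^bsub>S\<^esub> s \<odot>\<^bsub>S\<^esub> (x \<ominus>\<^bsub>S\<^esub> r \<odot>\<^bsub>S\<^esub> x)"
      if "x \<in> carrier S" for x
      using that r s by (simp add: u_def S.smult_l_distr S.smult_assoc1 S.smult_l_diff)
    moreover have "u \<odot>\<^bsub>S\<^esub> b = b"
    proof -
      have "u \<odot>\<^bsub>S\<^esub> b = r \<odot>\<^bsub>S\<^esub> b \<oplus>\<^bsub>S\<^esub> d"
        using u[OF b] s by (simp add: d_def)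
      also have "\<dots> = b"
        using b r by (simp add: d_def S.M.minus_eq S.M.a_lcomm S.M.r_neg)
      finally show ?thesis .
    qed
    \<comment> \<open>The correction vanishes on old elements because \<open>1 - r\<close> already
      kills them.\<close>
    moreover have "u \<odot>\<^bsub>S\<^esub> a = a" if "a \<in> A" for a
      using u[of a] that A r s by (auto simp: S.M.minus_eq S.M.r_neg)
    ultimately show ?case
      by blast
  qed
  then show ?thesis
    by auto
qed

text \<open>A scalar acting on \<open>x\<close> as the projection to coordinate \<open>i\<close>
  keeps that component of \<open>x\<close> inside every submodule containing \<open>x\<close>. So a
  submodule contains the components of its elements and is the box of its projections. The scalar
  may depend on \<open>x\<close>, as vectors are treated one at a time.\<close>

lemma submodules_finite_direct_sum_subset:
  assumes "finite I" and "ring R" and M: "\<And>i. i \<in> I \<Longrightarrow> left_module R (M i)"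
    and proj: "\<And>i x. \<lbrakk>i \<in> I; x \<in> carrier (finite_direct_sum I M)\<rbrakk> \<Longrightarrow>
      \<exists>r\<in>carrier R. r \<odot>\<^bsub>M i\<^esub> x i = x i \<and> (\<forall>j\<in>I - {i}. r \<odot>\<^bsub>M j\<^esub> x j = \<zero>\<^bsub>M j\<^esub>)"
  shows "submodules R (finite_direct_sum I M) \<subseteq> PiE I ` (\<Pi>\<^sub>E i\<in>I. submodules R (M i))"
proof
  let ?D = "finite_direct_sum I M"
  fix N
  assume "N \<in> submodules R ?D"
  then have N: "submodule N R ?D"
    by (simp add: submodules_def)
  have D: "left_module R ?D"
    by (rule left_module_finite_direct_sum[OF assms(2,3)])
  define P where "P = (\<lambda>i\<in>I. (\<lambda>x. x i) ` N)"
  have P: "submodule (P i) R (M i)" if i: "i \<in> I" for i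
    using submodule_image[OF D M[OF i] _ _ N, of "\<lambda>x. x i"] i
    by (auto simp: P_def hom_def)
  have "PiE I P = N"
  proof
    show "N \<subseteq> PiE I P"
      using submodule_subset[OF N] by (auto simp: P_def PiE_def)
    show "PiE I P \<subseteq> N"
    proof
      fix y
      assume y: "y \<in> PiE I P"
      have yM: "y j \<in> carrier (M j)" if "j \<in> I" for j
        using PiE_mem[OF y that] submodule_subset[OF P[OF that]] by blast
      \<comment> \<open>Different coordinates of \<open>y\<close> may come from different elements
        of \<open>N\<close>; for each \<open>i\<close>, the scalar \<open>r\<close> isolates
        coordinate \<open>i\<close> of its own \<open>x\<close>.\<close>
      have coord: "(\<lambda>j\<in>I. if j = i then y i else \<zero>\<^bsub>M j\<^esub>) \<in> N" if i: "i \<in> I" for i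
      proof -
        obtain x where x: "x \<in> N" "y i = x i"
          using PiE_mem[OF y i] i by (auto simp: P_def)
        then obtain r where r: "r \<in> carrier R" "r \<odot>\<^bsub>M i\<^esub> x i = x i"
            "\<forall>j\<in>I - {i}. r \<odot>\<^bsub>M j\<^esub> x j = \<zero>\<^bsub>M j\<^esub>"
          using proj[OF i] submodule_subset[OF N] by blast
        have "r \<odot>\<^bsub>?D\<^esub> x = (\<lambda>j\<in>I. if j = i then y i else \<zero>\<^bsub>M j\<^esub>)"
          using r x by (auto intro!: restrict_ext)
        with submodule_smult[OF N r(1) x(1)] show ?thesis
          by simp
      qed
      \<comment> \<open>Adds the isolated coordinates one by one, from the zero vector at empty
        \<open>F\<close> up to \<open>y\<close> at \<open>F = I\<close>.\<close>
      have "(\<lambda>j\<in>I. if j \<in> F then y j else \<zero>\<^bsub>M j\<^esub>) \<in> N" if "F \<subseteq> I" for F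
        using finite_subset[OF that assms(1)] that
      proof (induction F)
        case empty
        show ?case
          using submodule_zero[OF N] by (simp add: restrict_def)
      next
        case (insert i F)
        let ?u = "\<lambda>j\<in>I. if j = i then y i else \<zero>\<^bsub>M j\<^esub>"
        let ?v = "\<lambda>j\<in>I. if j \<in> F then y j else \<zero>\<^bsub>M j\<^esub>"
        have ag: "abelian_group (M j)" if "j \<in> I" for j
          using M[OF that] by (rule left_module.axioms)
        have "?u \<oplus>\<^bsub>?D\<^esub> ?v = (\<lambda>j\<in>I. if j \<in> insert i F then y j else \<zero>\<^bsub>M j\<^esub>)"
          using insert.hyps yM abelian_monoid.l_zero[OF abelian_group.axioms(1)[OF ag]]
            abelian_monoid.r_zero[OF abelian_group.axioms(1)[OF ag]]
            abelian_monoid.zero_closed[OF abelian_group.axioms(1)[OF ag]]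
          by (auto intro!: restrict_ext)
        moreover have "?u \<oplus>\<^bsub>?D\<^esub> ?v \<in> N"
          using insert.prems by (intro submodule_add[OF N] coord insert.IH) auto
        ultimately show ?case
          by (simp only:)
      qed
      from this[of I] have "(\<lambda>j\<in>I. y j) \<in> N"
        by (simp cong: restrict_cong)
      then show "y \<in> N"
        using y by (simp add: PiE_def extensional_restrict)
    qed
  qed
  moreover have "P \<in> (\<Pi>\<^sub>E i\<in>I. submodules R (M i))"
    using P by (auto simp: submodules_def P_def)
  ultimately show "N \<in> PiE I ` (\<Pi>\<^sub>E i\<in>I. submodules R (M i))"
    by blast
qed

section \<open>Isotypic components of a semisimple module\<close>

theorem mainTheorem7:
  fixes R :: "('a, 'r) ring_scheme"
    and M :: "('a, 'm, 'p) module_scheme"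
    and S :: "nat \<Rightarrow> ('a, 'b, 'q) module_scheme"
    and t :: "nat \<Rightarrow> nat"
    and n :: nat
  assumes "ring R"
    and "left_module R M"
    and "finite (submodules R M)"
    and "\<And>i. i \<in> {1..n} \<Longrightarrow> simple_module R (S i)"
    and "\<And>i j. i \<in> {1..n} \<Longrightarrow> j \<in> {1..n} \<Longrightarrow> i \<noteq> j \<Longrightarrow> \<not> module_isomorphic R (S i) (S j)"
    and "module_isomorphic R M (finite_direct_sum {1..n} (\<lambda>i. module_power (S i) (t i)))"
  shows "mu R M = (\<Prod>i = 1..n. mu R (module_power (S i) (t i)))"
proof -
  let ?P = "\<lambda>i. module_power (S i) (t i)"
  let ?D = "finite_direct_sum {1..n} ?P"
  have P: "left_module R (?P i)" if "i \<in> {1..n}" for i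
    unfolding module_power_def
    using assms(4)[OF that] by (intro left_module_finite_direct_sum assms(1)) (simp add: simple_module_def)
  have D: "left_module R ?D"
    by (rule left_module_finite_direct_sum[OF assms(1) P])
  obtain f where "f \<in> iso (add_monoid M) (add_monoid ?D)"
    and "\<And>a x. \<lbrakk>a \<in> carrier R; x \<in> carrier M\<rbrakk> \<Longrightarrow> f (a \<odot>\<^bsub>M\<^esub> x) = a \<odot>\<^bsub>?D\<^esub> f x"
    using assms(6) unfolding module_isomorphic_def by blast
  then have fin: "finite (submodules R ?D)"
    using submodules_bij_betw[OF assms(2) D] assms(3) bij_betw_finite by blast
  \<comment> \<open>Read entrywise, projecting to component \<open>i\<close> means fixing every
    entry of the tuple \<open>x i\<close> and killing every entry of the other tuples. This is a
    separation problem in the simple modules themselves.\<close>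
  have proj: "\<exists>r\<in>carrier R. r \<odot>\<^bsub>?P i\<^esub> x i = x i \<and> (\<forall>j\<in>{1..n} - {i}. r \<odot>\<^bsub>?P j\<^esub> x j = \<zero>\<^bsub>?P j\<^esub>)"
    if i: "i \<in> {1..n}" and x: "x \<in> carrier ?D" for i x
  proof -
    have xj: "x j \<in> ({1..t j} \<rightarrow>\<^sub>E carrier (S j))" if "j \<in> {1..n}" for j
      using x that by (auto simp: module_power_def)
    have xjk: "x j k \<in> carrier (S j)" if "j \<in> {1..n}" "k \<in> {1..t j}" for j k
      using PiE_mem[OF xj] that by blast
    \<comment> \<open>Pairs of a component \<open>j\<close> other than \<open>i\<close> and a
      position in its tuple: the entries to be annihilated.\<close>
    let ?Q = "SIGMA j:{1..n} - {i}. {1..t j}"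
    have "\<exists>r\<in>carrier R. (\<forall>q\<in>?Q. r \<odot>\<^bsub>S (fst q)\<^esub> x (fst q) (snd q) = \<zero>\<^bsub>S (fst q)\<^esub>)
        \<and> (\<forall>a\<in>x i ` {1..t i}. r \<odot>\<^bsub>S i\<^esub> a = a)"
      using i xjk by (intro separate_elements assms(1,4,5)) auto
    then obtain r where r: "r \<in> carrier R"
        "\<And>j k. \<lbrakk>j \<in> {1..n} - {i}; k \<in> {1..t j}\<rbrakk> \<Longrightarrow> r \<odot>\<^bsub>S j\<^esub> x j k = \<zero>\<^bsub>S j\<^esub>"
        "\<And>k. k \<in> {1..t i} \<Longrightarrow> r \<odot>\<^bsub>S i\<^esub> x i k = x i k"
      by fastforce
    have "r \<odot>\<^bsub>?P i\<^esub> x i = restrict (x i) {1..t i}"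
      using r(3) by (auto simp: module_power_def intro!: restrict_ext)
    also have "\<dots> = x i"
      by (rule PiE_restrict[OF xj[OF i]])
    finally have "r \<odot>\<^bsub>?P i\<^esub> x i = x i" .
    moreover have "r \<odot>\<^bsub>?P j\<^esub> x j = \<zero>\<^bsub>?P j\<^esub>" if "j \<in> {1..n} - {i}" for j
      using r(2)[OF that] by (auto simp: module_power_def intro!: restrict_ext)
    ultimately show ?thesis
      using r(1) by blast
  qed
  have "mu R M = mu R ?D"
    by (rule mu_isomorphic[OF assms(2) D assms(6)])
  also have "\<dots> = (\<Prod>i = 1..n. mu R (?P i))"
    by (intro mu_finite_direct_sum submodules_finite_direct_sum_subset assms(1) P fin proj) auto
  finally show ?thesis .
qed

end
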